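(* Fix $p,\alpha,g,f$ and the regulator's confidence level $x>0$. There exists a threshold $\zeta$ such that, for every price threshold $c$ with $0<c<\frac{(1-\alpha)p}{1-\alpha p}$, the regulator imposes a ban on short sales only if $$\frac{c\,\alpha(1-p)}{(1-\alpha)(p-c)}>\zeta .$$
   Context: Parameters: $p,\alpha\in(0,1)$, $g\in(0,1]$. The asset value $V$ is Bernoulli with $P(V=1)=p$, $P(V=0)=1-p$. A random variable $\eta_s\in[0,1]$, independent of $V$, has probability density $f$ on $[0,1]$; it is known to the market maker, but the regulator knows only $f$. One trader arrives. With probability $1-g$ he is inactive (no trade). With probability $g$ he is active; an active trader is informed with probability $\alpha$ and noise with probability $1-\alpha$. An active informed trader buys if $V=1$ and sells (or shorts) if $V=0$. An active noise trader sells (or shorts) with probability $\eta_s$ and buys with probability $1-\eta_s$, independently of $V$. Thus, given $\eta_s$, $P(Sell\mid\eta_s)=g(1-\alpha)\eta_s+g\alpha(1-p)$, $P(Buy\mid\eta_s)=g(1-\alpha)(1-\eta_s)+g\alpha p$, $P(\text{No Trade}\mid\eta_s)=1-g$. The price $q$ (short selling allowed) is the market maker's expectation of $V$ given $\eta_s$ and the observed action: $q=Bid=\frac{(1-\alpha)\eta_s p}{(1-\alpha)\eta_s+\alpha(1-p)}$ after a sell, $q=Ask=\frac{(1-\alpha)(1-\eta_s)p+\alpha p}{(1-\alpha)(1-\eta_s)+\alpha p}$ after a buy, and $q=p$ after no trade. $P(q<c)$ is the probability under the joint law of $\eta_s\sim f$ and the action. Regulator's behaviour: the regulator wants the probability of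 a price below $c$ to be kept below the level $x$, and considers acting only when it is violated; i.e. the regulator imposes a ban only if $P(q<c)>x$. *)

theory Defs
  imports "HOL-Probability.Probability"
begin

datatype trader = Inactive | Informed | Noise

datatype action = Sell | Buy | No_Trade

text \<open>A selling action covers both selling and short selling.\<close>

definition density_on_unit :: "(real \<Rightarrow> real) \<Rightarrow> bool" where
  "density_on_unit f \<longleftrightarrow>
     f \<in> borel_measurable borel \<and> (\<forall>e. 0 \<le> f e) \<and> (\<forall>e. e \<notin> {0..1} \<longrightarrow> f e = 0) \<and>
     (\<integral>\<^sup>+ e. ennreal (f e) \<partial>lborel) = 1"

definition asset_prob :: "real \<Rightarrow> bool \<Rightarrow> real" where
  "asset_prob p v = (if v then p else 1 - p)"

fun trader_prob :: "real \<Rightarrow> real \<Rightarrow> trader \<Rightarrow> real" where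
  "trader_prob \<alpha> g Inactive = 1 - g"
| "trader_prob \<alpha> g Informed = g * \<alpha>"
| "trader_prob \<alpha> g Noise = g * (1 - \<alpha>)"

text \<open>\<open>action_prob e v t a\<close> is the probability of the action \<open>a\<close>, given that the noise-selling
  parameter is \<open>e\<close>, the asset value is \<open>of_bool v\<close> and the trader is of kind \<open>t\<close>.\<close>

fun action_prob :: "real \<Rightarrow> bool \<Rightarrow> trader \<Rightarrow> action \<Rightarrow> real" where
  "action_prob e v Inactive a = of_bool (a = No_Trade)"
| "action_prob e v Informed a = of_bool (a = (if v then Buy else Sell))"
| "action_prob e v Noise Sell = e"
| "action_prob e v Noise Buy = 1 - e"
| "action_prob e v Noise No_Trade = 0"

text \<open>An outcome \<open>(e, v, t, a)\<close> consists of the noise-selling parameter \<open>\<eta>\<^sub>s = e\<close>, the asset value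
  \<open>V = of_bool v\<close>, the kind of the arriving trader, and the action. The product form of the density
  in \<open>e\<close>, \<open>v\<close>, \<open>t\<close> expresses their independence.\<close>

type_synonym outcome = "real \<times> bool \<times> trader \<times> action"

definition market :: "real \<Rightarrow> real \<Rightarrow> real \<Rightarrow> (real \<Rightarrow> real) \<Rightarrow> outcome measure" where
  "market p \<alpha> g f =
     density (lborel \<Otimes>\<^sub>M count_space UNIV)
       (\<lambda>(e, v, t, a). ennreal (f e * asset_prob p v * trader_prob \<alpha> g t * action_prob e v t a))"

definition asset_value :: "outcome \<Rightarrow> real" where
  "asset_value = (\<lambda>(e, v, t, a). of_bool v)"

definition observation :: "outcome \<Rightarrow> real \<times> action" where
  "observation = (\<lambda>(e, v, t, a). (e, a))"

definition market_maker_info :: "outcome measure" where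
  "market_maker_info = vimage_algebra UNIV observation (borel \<Otimes>\<^sub>M count_space UNIV)"

definition price :: "real \<Rightarrow> real \<Rightarrow> real \<Rightarrow> (real \<Rightarrow> real) \<Rightarrow> outcome \<Rightarrow> real" where
  "price p \<alpha> g f = real_cond_exp (market p \<alpha> g f) market_maker_info asset_value"

definition prob_price_below :: "real \<Rightarrow> real \<Rightarrow> real \<Rightarrow> (real \<Rightarrow> real) \<Rightarrow> real \<Rightarrow> real" where
  "prob_price_below p \<alpha> g f c =
     measure (market p \<alpha> g f) {\<omega> \<in> space (market p \<alpha> g f). price p \<alpha> g f \<omega> < c}"

text \<open>A ban policy \<open>ban\<close> says for which price thresholds \<open>c\<close> the regulator imposes the ban on short
  sales. His behaviour is only constrained by: no ban unless the confidence level is violated.\<close>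

definition regulator_policy ::
  "real \<Rightarrow> real \<Rightarrow> real \<Rightarrow> (real \<Rightarrow> real) \<Rightarrow> real \<Rightarrow> (real \<Rightarrow> bool) \<Rightarrow> bool" where
  "regulator_policy p \<alpha> g f x ban \<longleftrightarrow> (\<forall>c. ban c \<longrightarrow> prob_price_below p \<alpha> g f c > x)"

text \<open>The remaining lemmas confirm that the model has the intended action probabilities given
  \<open>\<eta>\<^sub>s\<close> and that its prices are the usual bid and ask.\<close>

fun obs_prob :: "real \<Rightarrow> real \<Rightarrow> real \<Rightarrow> real \<Rightarrow> action \<Rightarrow> real" where
  "obs_prob p \<alpha> g e Sell = g * (1 - \<alpha>) * e + g * \<alpha> * (1 - p)"
| "obs_prob p \<alpha> g e Buy = g * (1 - \<alpha>) * (1 - e) + g * \<alpha> * p"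
| "obs_prob p \<alpha> g e No_Trade = 1 - g"

fun quote :: "real \<Rightarrow> real \<Rightarrow> real \<Rightarrow> action \<Rightarrow> real" where
  "quote p \<alpha> e Sell = (1 - \<alpha>) * e * p / ((1 - \<alpha>) * e + \<alpha> * (1 - p))"
| "quote p \<alpha> e Buy = ((1 - \<alpha>) * (1 - e) * p + \<alpha> * p) / ((1 - \<alpha>) * (1 - e) + \<alpha> * p)"
| "quote p \<alpha> e No_Trade = p"

lemma UNIV_trader: "(UNIV :: trader set) = {Inactive, Informed, Noise}"
  using trader.exhaust by auto

lemma UNIV_action: "(UNIV :: action set) = {Sell, Buy, No_Trade}"
  using action.exhaust by auto

lemma UNIV_vta: "(UNIV :: (bool \<times> trader \<times> action) set) = UNIV \<times> UNIV \<times> UNIV"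
  by simp

lemma finite_vta: "finite (UNIV :: (bool \<times> trader \<times> action) set)"
  unfolding UNIV_vta by (intro finite_cartesian_product) (simp_all add: UNIV_trader UNIV_action)

lemma measurable_outcomeI:
  assumes "\<And>v t a. (\<lambda>e. F (e, v, t, a)) \<in> measurable borel N"
  shows "F \<in> measurable (borel \<Otimes>\<^sub>M count_space (UNIV :: (bool \<times> trader \<times> action) set)) N"
proof -
  have "(\<lambda>\<omega>. (\<lambda>i \<omega>. F (fst \<omega>, i)) (snd \<omega>) \<omega>) \<in>
      measurable (borel \<Otimes>\<^sub>M count_space (UNIV :: (bool \<times> trader \<times> action) set)) N"
  proof (rule measurable_compose_countable'[where I = UNIV and g = snd and f = "\<lambda>i \<omega>. F (fst \<omega>, i)"])
    fix i :: "bool \<times> trader \<times> action"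
    obtain v t a where i: "i = (v, t, a)" by (cases i)
    show "(\<lambda>\<omega>. F (fst \<omega>, i)) \<in> measurable (borel \<Otimes>\<^sub>M count_space UNIV) N"
      unfolding i by (rule measurable_compose[OF measurable_fst assms])
  qed (simp_all add: countable_finite finite_vta)
  then show ?thesis by simp
qed

lemma action_prob_measurable: "(\<lambda>e. action_prob e v t a) \<in> borel_measurable borel"
  by (cases t; cases a) simp_all

lemma market_density_measurable:
  assumes "density_on_unit f"
  shows "(\<lambda>(e, v, t, a). ennreal (f e * asset_prob p v * trader_prob \<alpha> g t * action_prob e v t a))
     \<in> borel_measurable (lborel \<Otimes>\<^sub>M count_space UNIV)"
proof -
  have [measurable]: "f \<in> borel_measurable borel" using assms by (simp add: density_on_unit_def)
  note action_prob_measurable[measurable]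
  have "(\<lambda>(e, v, t, a). ennreal (f e * asset_prob p v * trader_prob \<alpha> g t * action_prob e v t a))
     \<in> borel_measurable (borel \<Otimes>\<^sub>M count_space UNIV)"
    by (rule measurable_outcomeI) simp
  also have "borel_measurable (borel \<Otimes>\<^sub>M count_space (UNIV :: (bool \<times> trader \<times> action) set))
      = borel_measurable (lborel \<Otimes>\<^sub>M count_space UNIV)"
    by (intro measurable_cong_sets sets_pair_measure_cong) simp_all
  finally show ?thesis .
qed

lemma sets_market: "sets (market p \<alpha> g f) = sets (borel \<Otimes>\<^sub>M count_space UNIV)"
  unfolding market_def sets_density by (intro sets_pair_measure_cong) simp_all

lemma space_market: "space (market p \<alpha> g f) = UNIV"
  unfolding market_def by (simp add: space_pair_measure)

lemma nn_integral_market: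
  assumes f: "density_on_unit f"
    and F: "F \<in> borel_measurable (borel \<Otimes>\<^sub>M count_space UNIV)"
  shows "(\<integral>\<^sup>+ \<omega>. F \<omega> \<partial>market p \<alpha> g f) =
    (\<integral>\<^sup>+ e. (\<Sum>v\<in>UNIV. \<Sum>t\<in>UNIV. \<Sum>a\<in>UNIV.
       ennreal (f e * asset_prob p v * trader_prob \<alpha> g t * action_prob e v t a) * F (e, v, t, a)) \<partial>lborel)"
proof -
  let ?d = "\<lambda>(e, v, t, a). ennreal (f e * asset_prob p v * trader_prob \<alpha> g t * action_prob e v t a)"
  interpret C: sigma_finite_measure "count_space (UNIV :: (bool \<times> trader \<times> action) set)"
    by (rule sigma_finite_measure_count_space_finite[OF finite_vta])
  have eq: "borel_measurable (borel \<Otimes>\<^sub>M count_space (UNIV :: (bool \<times> trader \<times> action) set))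
      = (borel_measurable (lborel \<Otimes>\<^sub>M count_space UNIV) :: (_ \<Rightarrow> ennreal) set)"
    by (intro measurable_cong_sets sets_pair_measure_cong) simp_all
  have F': "F \<in> borel_measurable (lborel \<Otimes>\<^sub>M count_space UNIV)" using F eq by simp
  have d: "?d \<in> borel_measurable (lborel \<Otimes>\<^sub>M count_space UNIV)"
    by (rule market_density_measurable[OF f])
  have "(\<integral>\<^sup>+ \<omega>. F \<omega> \<partial>market p \<alpha> g f) =
      (\<integral>\<^sup>+ \<omega>. ?d \<omega> * F \<omega> \<partial>(lborel \<Otimes>\<^sub>M count_space UNIV))"
    unfolding market_def by (rule nn_integral_density[OF d F'])
  also have "\<dots> = (\<integral>\<^sup>+ e. \<integral>\<^sup>+ i. ?d (e, i) * F (e, i) \<partial>count_space UNIV \<partial>lborel)"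
    by (rule C.nn_integral_fst[symmetric]) (rule borel_measurable_times_ennreal[OF d F'])
  also have "\<dots> = (\<integral>\<^sup>+ e. (\<Sum>i\<in>UNIV. ?d (e, i) * F (e, i)) \<partial>lborel)"
    by (simp add: nn_integral_count_space_finite finite_vta)
  also have "\<dots> = (\<integral>\<^sup>+ e. (\<Sum>v\<in>UNIV. \<Sum>t\<in>UNIV. \<Sum>a\<in>UNIV. ?d (e, v, t, a) * F (e, v, t, a)) \<partial>lborel)"
    unfolding UNIV_vta by (simp only: sum.cartesian_product split_def fst_conv snd_conv prod.collapse)
  finally show ?thesis by simp
qed

lemma sum_vta:
  fixes h :: "bool \<Rightarrow> trader \<Rightarrow> action \<Rightarrow> 'b::comm_monoid_add"
  shows "(\<Sum>v\<in>UNIV. \<Sum>t\<in>UNIV. \<Sum>a\<in>UNIV. h v t a) = (\<Sum>a\<in>UNIV. \<Sum>v\<in>UNIV. \<Sum>t\<in>UNIV. h v t a)"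
proof -
  have "(\<Sum>v\<in>UNIV. \<Sum>t\<in>UNIV. \<Sum>a\<in>UNIV. h v t a) = (\<Sum>v\<in>UNIV. \<Sum>a\<in>UNIV. \<Sum>t\<in>UNIV. h v t a)"
    by (intro sum.cong refl sum.swap)
  also have "\<dots> = (\<Sum>a\<in>UNIV. \<Sum>v\<in>UNIV. \<Sum>t\<in>UNIV. h v t a)"
    by (rule sum.swap)
  finally show ?thesis .
qed

lemma obs_prob_eq:
  "(\<Sum>v\<in>UNIV. \<Sum>t\<in>UNIV. asset_prob p v * trader_prob \<alpha> g t * action_prob e v t a) = obs_prob p \<alpha> g e a"
  by (cases a) (simp_all add: UNIV_bool UNIV_trader asset_prob_def algebra_simps)

lemma quote_eq:
  assumes "0 < p" "p < 1" "0 < \<alpha>" "\<alpha> < 1" "0 \<le> e" "e \<le> 1"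
  shows "(\<Sum>v\<in>UNIV. \<Sum>t\<in>UNIV. asset_prob p v * trader_prob \<alpha> g t * action_prob e v t a * of_bool v)
    = obs_prob p \<alpha> g e a * quote p \<alpha> e a"
proof -
  have s: "(1 - \<alpha>) * e + \<alpha> * (1 - p) > 0" "(1 - \<alpha>) * (1 - e) + \<alpha> * p > 0"
    using assms by (auto intro!: add_nonneg_pos)
  have o: "obs_prob p \<alpha> g e Sell = g * ((1 - \<alpha>) * e + \<alpha> * (1 - p))"
    "obs_prob p \<alpha> g e Buy = g * ((1 - \<alpha>) * (1 - e) + \<alpha> * p)" by (simp_all add: algebra_simps)
  show ?thesis
  proof (cases a)
    case Sell
    show ?thesis unfolding Sell o quote.simps using s
      by (simp add: UNIV_bool UNIV_trader asset_prob_def)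
  next
    case Buy
    show ?thesis unfolding Buy o quote.simps using s
      by (simp add: UNIV_bool UNIV_trader asset_prob_def) (simp add: algebra_simps)
  next
    case No_Trade
    then show ?thesis by (simp add: UNIV_bool UNIV_trader asset_prob_def)
  qed
qed

lemma quote_bounds:
  assumes "0 < p" "p < 1" "0 < \<alpha>" "\<alpha> < 1" "0 \<le> e" "e \<le> 1"
  shows "0 \<le> quote p \<alpha> e a" "quote p \<alpha> e a \<le> 1"
proof -
  have n: "0 \<le> (1 - \<alpha>) * e" "0 < \<alpha> * (1 - p)" "0 \<le> (1 - \<alpha>) * (1 - e)" "0 < \<alpha> * p"
    using assms by auto
  have m: "(1 - \<alpha>) * e * p \<le> (1 - \<alpha>) * e" "(1 - \<alpha>) * (1 - e) * p \<le> (1 - \<alpha>) * (1 - e)"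
    using mult_left_mono[of p 1] n assms by fastforce+
  show "0 \<le> quote p \<alpha> e a" using n assms by (cases a) simp_all
  have "(1 - \<alpha>) * e * p \<le> (1 - \<alpha>) * e + \<alpha> * (1 - p)" using m n by linarith
  moreover have "(1 - \<alpha>) * (1 - e) * p + \<alpha> * p \<le> (1 - \<alpha>) * (1 - e) + \<alpha> * p" using m by linarith
  moreover have "0 < (1 - \<alpha>) * e + \<alpha> * (1 - p)" "0 < (1 - \<alpha>) * (1 - e) + \<alpha> * p"
    using n by linarith+
  ultimately show "quote p \<alpha> e a \<le> 1"
    using assms(2) by (cases a) simp_all
qed

lemma model_nonneg:
  assumes "0 < p" "p < 1" "0 < \<alpha>" "\<alpha> < 1" "0 < g" "g \<le> 1" "0 \<le> e" "e \<le> 1"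
  shows "0 \<le> asset_prob p v * trader_prob \<alpha> g t * action_prob e v t a"
  using assms by (cases t; cases a) (simp_all add: asset_prob_def)

lemma obs_prob_nonneg:
  assumes "0 < p" "p < 1" "0 < \<alpha>" "\<alpha> < 1" "0 < g" "g \<le> 1" "0 \<le> e" "e \<le> 1"
  shows "0 \<le> obs_prob p \<alpha> g e a"
  using assms by (cases a) simp_all

lemma nn_integral_market_observation:
  assumes par: "0 < p" "p < 1" "0 < \<alpha>" "\<alpha> < 1" "0 < g" "g \<le> 1" and f: "density_on_unit f"
    and F: "\<And>a. (\<lambda>e. F e a) \<in> borel_measurable borel"
  shows "(\<integral>\<^sup>+ (e, v, t, a). F e a \<partial>market p \<alpha> g f) =
    (\<integral>\<^sup>+ e. (\<Sum>a\<in>UNIV. ennreal (f e * obs_prob p \<alpha> g e a) * F e a) \<partial>lborel)"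
proof -
  have "(\<Sum>v\<in>UNIV. \<Sum>t\<in>UNIV. \<Sum>a\<in>UNIV.
       ennreal (f e * asset_prob p v * trader_prob \<alpha> g t * action_prob e v t a) * F e a)
     = (\<Sum>a\<in>UNIV. ennreal (f e * obs_prob p \<alpha> g e a) * F e a)" for e
  proof (cases "e \<in> {0..1}")
    case False
    then show ?thesis using f by (simp add: density_on_unit_def)
  next
    case True
    have fe: "0 \<le> f e" using f by (simp add: density_on_unit_def)
    have nn: "0 \<le> asset_prob p v * trader_prob \<alpha> g t * action_prob e v t a" for v t a
      using model_nonneg par True by simp
    show ?thesis
      unfolding sum_vta
    proof (rule sum.cong[OF refl])
      fix a
      have "(\<Sum>v\<in>UNIV. \<Sum>t\<in>UNIV.
          ennreal (f e * asset_prob p v * trader_prob \<alpha> g t * action_prob e v t a) * F e a)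
        = (\<Sum>v\<in>UNIV. \<Sum>t\<in>UNIV.
          ennreal (f e * (asset_prob p v * trader_prob \<alpha> g t * action_prob e v t a))) * F e a"
        by (simp add: sum_distrib_right mult.assoc)
      also have "\<dots> = ennreal (\<Sum>v\<in>UNIV. \<Sum>t\<in>UNIV.
          f e * (asset_prob p v * trader_prob \<alpha> g t * action_prob e v t a)) * F e a"
        by (simp add: sum_ennreal fe nn sum_nonneg)
      also have "\<dots> = ennreal (f e * obs_prob p \<alpha> g e a) * F e a"
        by (simp flip: sum_distrib_left add: obs_prob_eq)
      finally show "(\<Sum>v\<in>UNIV. \<Sum>t\<in>UNIV.
          ennreal (f e * asset_prob p v * trader_prob \<alpha> g t * action_prob e v t a) * F e a)
        = ennreal (f e * obs_prob p \<alpha> g e a) * F e a" .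
    qed
  qed
  moreover have "(\<lambda>(e, v, t, a). F e a) \<in> borel_measurable (borel \<Otimes>\<^sub>M count_space (UNIV :: (bool \<times> trader \<times> action) set))"
    by (rule measurable_outcomeI) (simp add: F)
  ultimately show ?thesis by (subst nn_integral_market[OF f]) simp_all
qed

lemma prob_space_market:
  assumes par: "0 < p" "p < 1" "0 < \<alpha>" "\<alpha> < 1" "0 < g" "g \<le> 1" and f: "density_on_unit f"
  shows "prob_space (market p \<alpha> g f)"
proof
  have "emeasure (market p \<alpha> g f) (space (market p \<alpha> g f)) = (\<integral>\<^sup>+ (e, v, t, a). 1 \<partial>market p \<alpha> g f)"
    by (simp add: split_def)
  also have "\<dots> = (\<integral>\<^sup>+ e. (\<Sum>a\<in>UNIV. ennreal (f e * obs_prob p \<alpha> g e a) * 1) \<partial>lborel)"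
    by (rule nn_integral_market_observation[OF par f]) simp
  also have "\<dots> = (\<integral>\<^sup>+ e. ennreal (f e) \<partial>lborel)"
  proof (rule nn_integral_cong)
    fix e
    show "(\<Sum>a\<in>UNIV. ennreal (f e * obs_prob p \<alpha> g e a) * 1) = ennreal (f e)"
    proof (cases "e \<in> {0..1}")
      case False
      then show ?thesis using f by (simp add: density_on_unit_def)
    next
      case True
      have fe: "0 \<le> f e" using f by (simp add: density_on_unit_def)
      have "(\<Sum>a\<in>UNIV. ennreal (f e * obs_prob p \<alpha> g e a) * 1)
          = ennreal (\<Sum>a\<in>UNIV. f e * obs_prob p \<alpha> g e a)"
        using obs_prob_nonneg par True fe by (simp add: sum_ennreal)
      also have "(\<Sum>a\<in>UNIV. f e * obs_prob p \<alpha> g e a) = f e"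
        by (simp add: UNIV_action algebra_simps)
      finally show ?thesis .
    qed
  qed
  also have "\<dots> = 1" using f by (simp add: density_on_unit_def)
  finally show "emeasure (market p \<alpha> g f) (space (market p \<alpha> g f)) = 1" .
qed

lemma observation_measurable:
  "observation \<in> measurable (market p \<alpha> g f) (borel \<Otimes>\<^sub>M count_space UNIV)"
proof -
  have "observation \<in> measurable (borel \<Otimes>\<^sub>M count_space UNIV) (borel \<Otimes>\<^sub>M count_space UNIV)"
    unfolding observation_def by (rule measurable_outcomeI) simp
  then show ?thesis by (simp cong: measurable_cong_sets add: sets_market)
qed

lemma subalgebra_market_maker_info: "subalgebra (market p \<alpha> g f) market_maker_info"
proof -
  have "sets market_maker_info \<subseteq> sets (market p \<alpha> g f)"
    unfolding market_maker_info_def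
    using measurable_sets[OF observation_measurable]
    by (auto simp: sets_vimage_algebra2 space_pair_measure space_market)
  then show ?thesis
    by (simp add: subalgebra_def space_market market_maker_info_def)
qed

lemma quote_measurable: "(\<lambda>e. quote p \<alpha> e a) \<in> borel_measurable borel"
  by (cases a) simp_all

lemma price_eq_quote:
  assumes par: "0 < p" "p < 1" "0 < \<alpha>" "\<alpha> < 1" "0 < g" "g \<le> 1" and f: "density_on_unit f"
  shows "AE \<omega> in market p \<alpha> g f.
    price p \<alpha> g f \<omega> = quote p \<alpha> (fst (observation \<omega>)) (snd (observation \<omega>))"
proof -
  let ?M = "market p \<alpha> g f"
  let ?q = "\<lambda>\<omega>. quote p \<alpha> (fst (observation \<omega>)) (snd (observation \<omega>))"
  interpret prob_space ?M by (rule prob_space_market[OF par f])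
  interpret finite_measure_subalgebra ?M market_maker_info
    by unfold_locales (rule subalgebra_market_maker_info)
  have q_pair: "(\<lambda>(e, a). quote p \<alpha> e a) \<in> borel_measurable (borel \<Otimes>\<^sub>M count_space UNIV)"
  proof -
    have "(\<lambda>z. (\<lambda>a z. quote p \<alpha> (fst z) a) (snd z) z) \<in> borel_measurable (borel \<Otimes>\<^sub>M count_space UNIV)"
      by (rule measurable_compose_countable'[where I = UNIV])
        (use measurable_compose[OF measurable_fst quote_measurable] in
          \<open>auto simp: UNIV_action intro: countable_finite\<close>)
    then show ?thesis by (simp add: split_def)
  qed
  have obs_info: "observation \<in> measurable market_maker_info (borel \<Otimes>\<^sub>M count_space UNIV)"
    unfolding market_maker_info_def by (rule measurable_vimage_algebra1) (simp add: space_pair_measure)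
  have q_info: "?q \<in> borel_measurable market_maker_info"
    using measurable_compose[OF obs_info q_pair] by (simp add: split_def)
  have q_M: "?q \<in> borel_measurable ?M"
    using measurable_compose[OF observation_measurable q_pair] by (simp add: split_def)
  have V_M: "asset_value \<in> borel_measurable ?M"
  proof -
    have "asset_value \<in> borel_measurable (borel \<Otimes>\<^sub>M count_space UNIV)"
      unfolding asset_value_def by (rule measurable_outcomeI) simp
    then show ?thesis by (simp cong: measurable_cong_sets add: sets_market)
  qed
  have AE_unit: "AE \<omega> in ?M. 0 \<le> fst \<omega> \<and> fst \<omega> \<le> 1"
  proof -
    have *: "AE \<omega> in lborel \<Otimes>\<^sub>M count_space (UNIV :: (bool \<times> trader \<times> action) set).
        0 < (case \<omega> of (e, v, t, a) \<Rightarrow>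
          ennreal (f e * asset_prob p v * trader_prob \<alpha> g t * action_prob e v t a)) \<longrightarrow>
        0 \<le> fst \<omega> \<and> fst \<omega> \<le> 1"
    proof (rule AE_I2, safe)
      fix e :: real and v t a
      assume "0 < ennreal (f e * asset_prob p v * trader_prob \<alpha> g t * action_prob e v t a)"
      then have "f e \<noteq> 0" by auto
      then have "e \<in> {0..1}" using f by (auto simp: density_on_unit_def)
      then show "0 \<le> fst (e, v, t, a)" "fst (e, v, t, a) \<le> 1" by simp_all
    qed
    show ?thesis
      unfolding market_def
      by (subst AE_density[OF market_density_measurable[OF f]]) (rule *)
  qed
  have fst_obs: "fst (observation \<omega>) = fst \<omega>" for \<omega>
    by (simp add: observation_def split_def)
  have q_bnd: "AE \<omega> in ?M. 0 \<le> ?q \<omega> \<and> ?q \<omega> \<le> 1"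
    using AE_unit by eventually_elim (simp add: quote_bounds par fst_obs)
  have V_int: "integrable ?M asset_value"
    by (rule integrable_const_bound[where B = 1, OF _ V_M]) (simp add: asset_value_def split_def)
  have q_int: "integrable ?M ?q"
    by (rule integrable_const_bound[where B = 1]) (use q_bnd q_M in auto)
  have eq: "(\<integral>\<omega>\<in>A. asset_value \<omega> \<partial>?M) = (\<integral>\<omega>\<in>A. ?q \<omega> \<partial>?M)" if A: "A \<in> sets market_maker_info" for A
  proof -
    obtain B where B: "B \<in> sets (borel \<Otimes>\<^sub>M count_space UNIV)" "A = observation -` B"
      using A unfolding market_maker_info_def by (auto simp: sets_vimage_algebra2 space_pair_measure)
    have AM: "A \<in> sets ?M" using A subalgebra_market_maker_info[of p \<alpha> g f] by (auto simp: subalgebra_def)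
    have Bm: "(\<lambda>e. indicator B (e, a) :: ennreal) \<in> borel_measurable borel" for a :: action
      by (rule measurable_compose[OF _ borel_measurable_indicator[OF B(1)]]) simp
    have "(\<integral>\<^sup>+ \<omega>. ennreal (asset_value \<omega>) * indicator A \<omega> \<partial>?M) =
        (\<integral>\<^sup>+ e. (\<Sum>v\<in>UNIV. \<Sum>t\<in>UNIV. \<Sum>a\<in>UNIV.
          ennreal (f e * asset_prob p v * trader_prob \<alpha> g t * action_prob e v t a) *
            (ennreal (of_bool v) * indicator B (e, a))) \<partial>lborel)"
    proof (subst nn_integral_market[OF f])
      show "(\<lambda>\<omega>. ennreal (asset_value \<omega>) * indicator A \<omega>) \<in> borel_measurable (borel \<Otimes>\<^sub>M count_space UNIV)"
        using V_M AM by (simp cong: measurable_cong_sets add: sets_market)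
    qed (simp add: asset_value_def B(2) observation_def indicator_vimage[unfolded comp_def])
    also have "\<dots> = (\<integral>\<^sup>+ e. (\<Sum>a\<in>UNIV. ennreal (f e * obs_prob p \<alpha> g e a) *
            (ennreal (quote p \<alpha> e a) * indicator B (e, a))) \<partial>lborel)"
    proof (rule nn_integral_cong)
      fix e
      show "(\<Sum>v\<in>UNIV. \<Sum>t\<in>UNIV. \<Sum>a\<in>UNIV.
          ennreal (f e * asset_prob p v * trader_prob \<alpha> g t * action_prob e v t a) *
            (ennreal (of_bool v) * indicator B (e, a))) =
          (\<Sum>a\<in>UNIV. ennreal (f e * obs_prob p \<alpha> g e a) *
            (ennreal (quote p \<alpha> e a) * indicator B (e, a)))"
      proof (cases "e \<in> {0..1}")
        case False
        then show ?thesis using f by (simp add: density_on_unit_def)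
      next
        case True
        have fe: "0 \<le> f e" using f by (simp add: density_on_unit_def)
        have nn: "0 \<le> asset_prob p v * trader_prob \<alpha> g t * action_prob e v t a" for v t a
          using model_nonneg par True by simp
        show ?thesis
          unfolding sum_vta
        proof (rule sum.cong[OF refl])
          fix a
          have "(\<Sum>v\<in>UNIV. \<Sum>t\<in>UNIV.
              ennreal (f e * asset_prob p v * trader_prob \<alpha> g t * action_prob e v t a) *
                (ennreal (of_bool v) * indicator B (e, a)))
            = (\<Sum>v\<in>UNIV. \<Sum>t\<in>UNIV.
              ennreal (f e * (asset_prob p v * trader_prob \<alpha> g t * action_prob e v t a * of_bool v)))
                * indicator B (e, a)"
            unfolding sum_distrib_right by (intro sum.cong refl) (simp add: of_bool_def mult.assoc)
          also have "\<dots> = ennreal (\<Sum>v\<in>UNIV. \<Sum>t\<in>UNIV.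
              f e * (asset_prob p v * trader_prob \<alpha> g t * action_prob e v t a * of_bool v))
                * indicator B (e, a)"
            by (simp add: sum_ennreal fe nn sum_nonneg)
          also have "\<dots> = ennreal (f e * (obs_prob p \<alpha> g e a * quote p \<alpha> e a)) * indicator B (e, a)"
            using quote_eq[of p \<alpha> e g a] par True by (simp flip: sum_distrib_left)
          also have "\<dots> = ennreal (f e * obs_prob p \<alpha> g e a) *
              (ennreal (quote p \<alpha> e a) * indicator B (e, a))"
            using quote_bounds(1)[of p \<alpha> e a] par True
            by (simp add: ennreal_mult'' mult.assoc flip: mult.assoc)
          finally show "(\<Sum>v\<in>UNIV. \<Sum>t\<in>UNIV.
              ennreal (f e * asset_prob p v * trader_prob \<alpha> g t * action_prob e v t a) *
                (ennreal (of_bool v) * indicator B (e, a))) = \<dots>" .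
        qed
      qed
    qed
    also have "\<dots> = (\<integral>\<^sup>+ (e, v, t, a). ennreal (quote p \<alpha> e a) * indicator B (e, a) \<partial>?M)"
      by (rule nn_integral_market_observation[OF par f, symmetric])
        (use Bm quote_measurable in measurable)
    also have "\<dots> = (\<integral>\<^sup>+ \<omega>. ennreal (?q \<omega>) * indicator A \<omega> \<partial>?M)"
      by (rule nn_integral_cong) (auto simp: B(2) observation_def split: split_indicator)
    finally have *: "(\<integral>\<^sup>+ \<omega>. ennreal (asset_value \<omega>) * indicator A \<omega> \<partial>?M)
        = (\<integral>\<^sup>+ \<omega>. ennreal (?q \<omega>) * indicator A \<omega> \<partial>?M)" .
    have "(\<integral>\<omega>\<in>A. asset_value \<omega> \<partial>?M) = enn2real (\<integral>\<^sup>+ \<omega>. ennreal (indicator A \<omega> *\<^sub>R asset_value \<omega>) \<partial>?M)"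
      unfolding set_lebesgue_integral_def
      by (rule integral_eq_nn_integral) (use V_M AM in \<open>auto simp: asset_value_def\<close>)
    also have "(\<integral>\<^sup>+ \<omega>. ennreal (indicator A \<omega> *\<^sub>R asset_value \<omega>) \<partial>?M)
        = (\<integral>\<^sup>+ \<omega>. ennreal (asset_value \<omega>) * indicator A \<omega> \<partial>?M)"
      by (rule nn_integral_cong) (simp split: split_indicator)
    also note *
    also have "(\<integral>\<^sup>+ \<omega>. ennreal (?q \<omega>) * indicator A \<omega> \<partial>?M)
        = (\<integral>\<^sup>+ \<omega>. ennreal (indicator A \<omega> *\<^sub>R ?q \<omega>) \<partial>?M)"
      by (rule nn_integral_cong) (simp split: split_indicator)
    also have "enn2real \<dots> = (\<integral>\<omega>\<in>A. ?q \<omega> \<partial>?M)"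
      unfolding set_lebesgue_integral_def
    proof (rule integral_eq_nn_integral[symmetric])
      show "AE \<omega> in ?M. 0 \<le> indicator A \<omega> *\<^sub>R ?q \<omega>"
        using q_bnd by eventually_elim (simp split: split_indicator)
    qed (use q_M AM in auto)
    finally show ?thesis .
  qed
  show ?thesis
    unfolding price_def by (rule real_cond_exp_charact[OF eq V_int q_int q_info])
qed

end

(* Below the prior p, only the bid can be the price, and for c < p the bid lies below c exactly if
   eta_s is below t = c alpha (1 - p) / ((1 - alpha) (p - c)). Hence P(q < c) is the probability G(t)
   of a sale with eta_s < t. This G is nondecreasing and left-continuous, so {t. x < G t} is an open
   up-set; it is bounded below because G(0) = 0 < x, and its infimum is the threshold. *)
theory Submission
  imports Defs
begin

text \<open>By \<open>left\<close> the superlevel set has no least element, so it is the open ray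
  above its infimum. The bound \<open>b\<close> covers the case where \<open>G\<close> never exceeds
  \<open>x\<close>: an empty set has no real threshold, but \<open>b\<close> then serves for all
  \<open>t \<le> b\<close>.\<close>

lemma superlevel_threshold:
  fixes G :: "real \<Rightarrow> real"
  assumes "mono G" "G l \<le> x"
    and left: "\<And>t. x < G t \<Longrightarrow> \<exists>s<t. x < G s"
  shows "\<exists>\<zeta>. \<forall>t\<le>b. x < G t \<longleftrightarrow> \<zeta> < t"
proof (cases "x < G b")
  case False
  \<comment> \<open>Both sides are false here.\<close>
  have "x < G t \<longleftrightarrow> b < t" if "t \<le> b" for t
    using monoD[OF \<open>mono G\<close> that] False that by linarith
  then show ?thesis by (intro exI[of _ b] allI impI)
next
  case True
  let ?S = "{t. x < G t}"
  have "l \<le> t" if "x < G t" for t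
  proof (rule ccontr)
    assume "\<not> l \<le> t"
    then have "G t \<le> G l" by (intro monoD[OF \<open>mono G\<close>]) simp
    then show False using that \<open>G l \<le> x\<close> by linarith
  qed
  then have bdd: "bdd_below ?S" by (intro bdd_belowI[of _ l]) (unfold mem_Collect_eq)
  have "x < G t \<longleftrightarrow> Inf ?S < t" for t
  proof
    assume "x < G t"
    from left[OF this] obtain s where "s < t" "x < G s" by blast
    moreover from \<open>x < G s\<close> have "Inf ?S \<le> s" by (intro cInf_lower bdd) simp
    ultimately show "Inf ?S < t" by linarith
  next
    assume "Inf ?S < t"
    then obtain s where "s < t" "x < G s"
      using True cInf_lessD[of ?S t] by fastforce
    moreover from \<open>s < t\<close> have "G s \<le> G t" by (intro monoD[OF \<open>mono G\<close>]) simp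
    ultimately show "x < G t" by linarith
  qed
  then show ?thesis by (intro exI[of _ "Inf ?S"] allI impI)
qed

text \<open>Clearing the positive denominator leaves
  \<open>(1 - \<alpha>) * (p - c) * e < c * \<alpha> * (1 - p)\<close>; since \<open>c < p\<close>,
  dividing by the factor of \<open>e\<close> keeps the direction.\<close>

lemma sell_quote_less_iff:
  assumes "0 < p" "p < 1" "0 < \<alpha>" "\<alpha> < 1" "0 \<le> e" "c < p"
  shows "quote p \<alpha> e Sell < c \<longleftrightarrow> e < c * \<alpha> * (1 - p) / ((1 - \<alpha>) * (p - c))"
proof -
  have "0 < (1 - \<alpha>) * e + \<alpha> * (1 - p)" "0 < (1 - \<alpha>) * (p - c)"
    using assms by (auto intro!: add_nonneg_pos)
  then show ?thesis by (simp add: pos_divide_less_eq pos_less_divide_eq algebra_simps)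
qed

text \<open>A buy is never bad news about the asset: once the denominator is cleared and the common
  noise term cancelled, what remains is
  \<open>p * (\<alpha> * p) \<le> \<alpha> * p\<close>.\<close>

lemma prior_le_buy_quote:
  assumes "0 < p" "p < 1" "0 < \<alpha>" "\<alpha> < 1" "e \<le> 1"
  shows "p \<le> quote p \<alpha> e Buy"
proof -
  have "0 < (1 - \<alpha>) * (1 - e) + \<alpha> * p"
    using assms by (auto intro!: add_nonneg_pos)
  moreover have "p * (\<alpha> * p) \<le> \<alpha> * p"
    using assms by (simp add: mult_le_cancel_right1)
  ultimately show ?thesis by (simp add: pos_le_divide_eq algebra_simps)
qed

text \<open>The density of \<open>market\<close> has the factor \<open>f e\<close>, which vanishes
  off the unit interval. The comparisons of quotes rely on these bounds.\<close>

lemma AE_market_unit: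
  assumes f: "density_on_unit f"
  shows "AE \<omega> in market p \<alpha> g f. 0 \<le> fst \<omega> \<and> fst \<omega> \<le> 1"
proof -
  have unit: "0 \<le> e \<and> e \<le> 1" if "0 < ennreal (f e * d1 * d2 * d3)" for e d1 d2 d3
  proof -
    have "f e \<noteq> 0" using that by (metis ennreal_0 less_irrefl mult_zero_left)
    then show ?thesis using f by (auto simp: density_on_unit_def)
  qed
  show ?thesis
    unfolding market_def AE_density[OF market_density_measurable[OF f]]
    by (intro AE_I2 impI) (unfold split_def, erule unit)
qed

text \<open>Phrased through the observation alone, this event is free of conditional expectations
  and nested in \<open>s\<close>.\<close>

definition sell_below :: "real \<Rightarrow> outcome set" where
  "sell_below s = {\<omega>. fst (observation \<omega>) < s \<and> snd (observation \<omega>) = Sell}"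

lemma sell_below_sets: "sell_below s \<in> sets (market p \<alpha> g f)"
proof -
  have "sell_below s = observation -` ({..<s} \<times> {Sell}) \<inter> space (market p \<alpha> g f)"
    by (auto simp: sell_below_def space_market mem_Times_iff)
  also have "\<dots> \<in> sets (market p \<alpha> g f)"
    by (rule measurable_sets[OF observation_measurable]) simp
  finally show ?thesis .
qed

text \<open>A conditional expectation is fixed only up to null sets, so the two events are compared
  almost everywhere.\<close>

lemma prob_price_below_eq:
  assumes par: "0 < p" "p < 1" "0 < \<alpha>" "\<alpha> < 1" "0 < g" "g \<le> 1" and f: "density_on_unit f"
    and c: "c < p"
  shows "prob_price_below p \<alpha> g f c =
    measure (market p \<alpha> g f) (sell_below (c * \<alpha> * (1 - p) / ((1 - \<alpha>) * (p - c))))"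
  unfolding prob_price_below_def
proof (rule measure_eq_AE)
  let ?M = "market p \<alpha> g f"
  let ?t = "c * \<alpha> * (1 - p) / ((1 - \<alpha>) * (p - c))"
  \<comment> \<open>After a buy the quote is at least \<open>p\<close>, after no trade it equals
    \<open>p\<close>; both exceed \<open>c\<close>, so only a sale remains.\<close>
  have below: "quote p \<alpha> e a < c \<longleftrightarrow> e < ?t \<and> a = Sell" if "0 \<le> e" "e \<le> 1" for e a
    using sell_quote_less_iff[of p \<alpha> e c] prior_le_buy_quote[of p \<alpha> e] par c that
    by (cases a) (simp_all del: quote.simps(1,2))
  show "AE \<omega> in ?M. \<omega> \<in> {\<omega> \<in> space ?M. price p \<alpha> g f \<omega> < c} \<longleftrightarrow> \<omega> \<in> sell_below ?t"
    using price_eq_quote[OF par f] AE_market_unit[OF f]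
  proof eventually_elim
    case (elim \<omega>)
    moreover have "fst (observation \<omega>) = fst \<omega>" by (simp add: observation_def split_def)
    ultimately show ?case by (simp add: below sell_below_def space_market)
  qed
  have "price p \<alpha> g f \<in> borel_measurable ?M"
    unfolding price_def by (rule borel_measurable_cond_exp2)
  then show "{\<omega> \<in> space ?M. price p \<alpha> g f \<omega> < c} \<in> sets ?M" by measurable
qed (rule sell_below_sets)

text \<open>Supplies the point where the probability does not exceed \<open>x\<close>.\<close>

lemma measure_sell_below_nonpos:
  assumes f: "density_on_unit f" and "s \<le> 0"
  shows "measure (market p \<alpha> g f) (sell_below s) = 0"
proof -
  have "AE \<omega> in market p \<alpha> g f. \<omega> \<notin> sell_below s"
    using AE_market_unit[OF f]
    by eventually_elim (use \<open>s \<le> 0\<close> in \<open>auto simp: sell_below_def observation_def split_def\<close>)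
  then show ?thesis
    using measure_eq_AE[of "sell_below s" "{}" "market p \<alpha> g f"] by (simp add: sell_below_sets)
qed

text \<open>Continuity from below along a sequence of reals increasing strictly to \<open>t\<close>:
  the limit exceeds \<open>x\<close>, hence so does some term.\<close>

lemma (in finite_measure) measure_UN_less_ex:
  fixes A :: "real \<Rightarrow> 'a set"
  assumes sets: "\<And>s. A s \<in> sets M" and "mono A"
    and UN: "A t \<subseteq> (\<Union>s\<in>{..<t}. A s)" and x: "x < measure M (A t)"
  shows "\<exists>s<t. x < measure M (A s)"
proof -
  let ?s = "\<lambda>n. t - 1 / real (Suc n)"
  have "incseq (\<lambda>n. A (?s n))"
    by (intro monoI monoD[OF \<open>mono A\<close>]) (simp add: frac_le)
  then have "(\<lambda>n. measure M (A (?s n))) \<longlonglongrightarrow> measure M (\<Union>n. A (?s n))"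
    by (intro finite_Lim_measure_incseq) (use sets in auto)
  moreover have "(\<Union>n. A (?s n)) = A t"
  proof
    show "(\<Union>n. A (?s n)) \<subseteq> A t" by (intro UN_least monoD[OF \<open>mono A\<close>]) simp
    show "A t \<subseteq> (\<Union>n. A (?s n))"
    proof
      fix \<omega> assume "\<omega> \<in> A t"
      then obtain s where "s < t" "\<omega> \<in> A s" using UN by blast
      moreover obtain n where "1 / real (Suc n) < t - s"
        using nat_approx_posE[of "t - s"] \<open>s < t\<close> by (metis diff_gt_0_iff_gt)
      ultimately show "\<omega> \<in> (\<Union>n. A (?s n))"
        using monoD[OF \<open>mono A\<close>, of s "?s n"] by auto
    qed
  qed
  ultimately have "eventually (\<lambda>n. x < measure M (A (?s n))) sequentially"
    using x by (auto intro: order_tendstoD)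
  then obtain n where "x < measure M (A (?s n))" by (auto simp: eventually_sequentially)
  then show ?thesis by (intro exI[of _ "?s n"]) simp
qed

theorem mainTheorem2:
  fixes p \<alpha> g x :: real and f :: "real \<Rightarrow> real"
  assumes "0 < p" "p < 1" "0 < \<alpha>" "\<alpha> < 1" "0 < g" "g \<le> 1"
    and "density_on_unit f"
    and "0 < x"
  shows "\<exists>\<zeta>.
    (\<forall>ban. regulator_policy p \<alpha> g f x ban \<longrightarrow>
       (\<forall>c. 0 < c \<and> c < (1 - \<alpha>) * p / (1 - \<alpha> * p) \<longrightarrow>
          ban c \<longrightarrow> c * \<alpha> * (1 - p) / ((1 - \<alpha>) * (p - c)) > \<zeta>)) \<and>
    (\<forall>c. 0 < c \<and> c < (1 - \<alpha>) * p / (1 - \<alpha> * p) \<longrightarrow>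
       (prob_price_below p \<alpha> g f c > x \<longleftrightarrow> c * \<alpha> * (1 - p) / ((1 - \<alpha>) * (p - c)) > \<zeta>))"
proof -
  let ?t = "\<lambda>c. c * \<alpha> * (1 - p) / ((1 - \<alpha>) * (p - c))"
  let ?G = "\<lambda>s. measure (market p \<alpha> g f) (sell_below s)"
  note par = assms(1-6) and f = assms(7)
  interpret prob_space "market p \<alpha> g f" by (rule prob_space_market[OF par f])
  have mono_sell: "mono sell_below" by (intro monoI) (auto simp: sell_below_def)
  \<comment> \<open>The bound 1 suffices: the range allowed for \<open>c\<close> forces
    \<open>?t c \<le> 1\<close>.\<close>
  have "\<exists>\<zeta>. \<forall>s\<le>1. x < ?G s \<longleftrightarrow> \<zeta> < s"
  proof (rule superlevel_threshold)
    show "mono ?G"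
      by (intro monoI finite_measure_mono monoD[OF mono_sell] sell_below_sets)
    show "?G 0 \<le> x" using measure_sell_below_nonpos[OF f] \<open>0 < x\<close> by simp
    fix s assume "x < ?G s"
    \<comment> \<open>Left-continuity comes from the strict inequality in \<open>sell_below\<close>:
      some real lies between the noise parameter and \<open>s\<close>.\<close>
    moreover have "sell_below s \<subseteq> (\<Union>r\<in>{..<s}. sell_below r)"
      using dense by (auto simp: sell_below_def)
    ultimately show "\<exists>r<s. x < ?G r"
      by (intro measure_UN_less_ex sell_below_sets mono_sell)
  qed
  then obtain \<zeta> where \<zeta>: "x < ?G s \<longleftrightarrow> \<zeta> < s" if "s \<le> 1" for s by blast
  have iff: "x < prob_price_below p \<alpha> g f c \<longleftrightarrow> \<zeta> < ?t c"
    if c: "c < (1 - \<alpha>) * p / (1 - \<alpha> * p)" "0 < c" for c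
  proof -
    have "\<alpha> * p < 1" using par mult_strict_mono[of \<alpha> 1 p 1] by simp
    then have c': "c * (1 - \<alpha> * p) < (1 - \<alpha>) * p" using c by (simp add: pos_less_divide_eq)
    have "0 < \<alpha> * (1 - p) * c" using par c by simp
    \<comment> \<open>Dropping the positive second summand turns the bound on \<open>c\<close> into
      \<open>c < p\<close>.\<close>
    moreover have "c * (1 - \<alpha> * p) = (1 - \<alpha>) * c + \<alpha> * (1 - p) * c" by (simp add: algebra_simps)
    ultimately have "(1 - \<alpha>) * c < (1 - \<alpha>) * p" using c' by linarith
    then have "c < p" using par by simp
    moreover from this have "0 < (1 - \<alpha>) * (p - c)" using par by simp
    \<comment> \<open>With denominators cleared, this is the weak form of \<open>c'\<close>.\<close>
    then have "?t c \<le> 1" using c' by (subst divide_le_eq_1_pos) (simp_all add: algebra_simps)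
    ultimately show ?thesis using prob_price_below_eq[OF par f] \<zeta> by simp
  qed
  \<comment> \<open>A ban entails a probability above \<open>x\<close>, so the claim about policies
    is one direction of \<open>iff\<close>.\<close>
  then show ?thesis unfolding regulator_policy_def by (intro exI[of _ \<zeta>]) blast
qed

end
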